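(* Let $m$ be a positive integer with $m\in\operatorname{Im}(P)$. Then $f(m)$ equals the total number, over all pairs of non-negative integers $(a,b)$ with $a\equiv b\pmod 2$ and $m=b^2+2a$, of non-negative integer solutions $(x_1,\ldots,x_b)=(c_1,\ldots,c_b)$ with $c_1\ge c_2\ge\cdots\ge c_b\ge 0$ of the system $$b=x_1+\cdots+x_b,\qquad a=x_1^2+\cdots+x_b^2.$$
   Context: $\mathcal{M}$ is the set of all two-line matrices $M=\begin{pmatrix} c_1 & \cdots & c_s\\ d_1 & \cdots & d_s\end{pmatrix}$ ($s\ge1$) with non-negative integer entries satisfying $c_s=0$, $d_s\ne0$, and $c_j=c_{j+1}+d_{j+1}$ for $1\le j\le s-1$; $\mathcal{M}_0$ is the subset of those with $d_1=0$. With $\ell(M)$ the sum of all entries and $N=\ell(M)-d_1$, $P(M)$ is the sum of the numbers $2\big(N-(d_2+\cdots+d_k)-(c_1+\cdots+c_{k-1})-i\big)-1$ over $k=1,\ldots,s-1$ and $i=0,\ldots,c_k-1$; $\operatorname{Im}(P)$ is the image of $P$ on $\mathcal{M}$. The frequency $f(m)$ is the number of $M\in\mathcal{M}_0$ with $P(M)=m$. *)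

theory Defs
  imports Complex_Main "HOL-Number_Theory.Cong"
begin

text \<open>A two-line matrix is the list of its columns \<open>(c, d)\<close>; its entries are indexed from 1.\<close>

type_synonym two_line = "(nat \<times> nat) list"

definition top_entry :: "two_line \<Rightarrow> nat \<Rightarrow> nat" where
  "top_entry M j = fst (M ! (j - 1))"

definition bot_entry :: "two_line \<Rightarrow> nat \<Rightarrow> nat" where
  "bot_entry M j = snd (M ! (j - 1))"

definition two_line_matrices :: "two_line set" where
  "two_line_matrices = {M. length M \<ge> 1
     \<and> top_entry M (length M) = 0 \<and> bot_entry M (length M) \<noteq> 0
     \<and> (\<forall>j\<in>{1..length M - 1}. top_entry M j = top_entry M (j + 1) + bot_entry M (j + 1))}"

definition two_line_matrices0 :: "two_line set" where
  "two_line_matrices0 = {M \<in> two_line_matrices. bot_entry M 1 = 0}"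

definition entry_sum :: "two_line \<Rightarrow> nat" where
  "entry_sum M = (\<Sum>j=1..length M. top_entry M j + bot_entry M j)"

text \<open>The summands are taken in the integers, so that no subtraction is truncated.\<close>

definition path_value :: "two_line \<Rightarrow> int" where
  "path_value M =
     (let N = int (entry_sum M) - int (bot_entry M 1) in
      \<Sum>k=1..length M - 1. \<Sum>i<top_entry M k.
        2 * (N - (\<Sum>j=2..k. int (bot_entry M j))
               - (\<Sum>j=1..k - 1. int (top_entry M j)) - int i) - 1)"

definition frequency :: "int \<Rightarrow> nat" where
  "frequency m = card {M \<in> two_line_matrices0. path_value M = m}"

definition system_solutions :: "nat \<Rightarrow> nat \<Rightarrow> nat list set" where
  "system_solutions a b = {xs. length xs = b \<and> sorted_wrt (\<ge>) xs
     \<and> b = (\<Sum>x\<leftarrow>xs. x) \<and> a = (\<Sum>x\<leftarrow>xs. x\<^sup>2)}"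

end

theory Submission imports Defs begin

text \<open>The recursion for the entries gives
  \<open>c\<^sub>k = d\<^sub>k\<^sub>+\<^sub>1 + \<dots> + d\<^sub>s\<close>, so the summands with index \<open>k\<close> in \<open>P(M)\<close> add up to
  \<open>c\<^sub>k\<^sup>2 + 2 c\<^sub>k (c\<^sub>k + \<dots> + c\<^sub>s)\<close>, and \<open>P(M) = b\<^sup>2 + 2a\<close> where \<open>b\<close> is the sum of the \<open>c\<^sub>k\<close> and
  \<open>a\<close> the sum of their squares. A matrix with \<open>d\<^sub>1 = 0\<close> is determined by its top row, which is an
  arbitrary nonempty partition \<open>c\<^sub>1 \<ge> \<dots> \<ge> c\<^sub>s\<^sub>-\<^sub>1 > 0\<close> followed by \<open>c\<^sub>s = 0\<close>. A partition of \<open>b\<close> has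
  at most \<open>b\<close> parts, so padding it with zeros gives exactly one solution of the system of length
  \<open>b\<close>; the congruence \<open>a \<equiv> b\<close> holds because \<open>x\<^sup>2 \<equiv> x\<close> modulo 2.\<close>

section \<open>Matrices, entry sums and path values, column by column\<close>

lemma top_entry_Cons_1 [simp]: "top_entry (x # M) (Suc 0) = fst x"
  by (simp add: top_entry_def)

lemma bot_entry_Cons_1 [simp]: "bot_entry (x # M) (Suc 0) = snd x"
  by (simp add: bot_entry_def)

lemma top_entry_Cons_Suc: "j \<ge> 1 \<Longrightarrow> top_entry (x # M) (Suc j) = top_entry M j"
  by (cases j) (auto simp: top_entry_def)

lemma bot_entry_Cons_Suc: "j \<ge> 1 \<Longrightarrow> bot_entry (x # M) (Suc j) = bot_entry M j"
  by (cases j) (auto simp: bot_entry_def)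

lemma two_line_matrices_singleton: "[x] \<in> two_line_matrices \<longleftrightarrow> fst x = 0 \<and> snd x \<noteq> 0"
  by (simp add: two_line_matrices_def)

lemma two_line_matrices_Cons:
  assumes "M \<noteq> []"
  shows "x # M \<in> two_line_matrices \<longleftrightarrow>
    M \<in> two_line_matrices \<and> fst x = fst (hd M) + snd (hd M)"
proof -
  obtain y M' where M: "M = y # M'"
    using assms by (cases M) auto
  have split: "{1..length (x # M) - 1} = insert 1 (Suc ` {1..length M - 1})"
    by (auto simp: M image_iff Suc_le_eq gr0_conv_Suc Bex_def) presburger
  have ball: "(\<forall>j\<in>{1..length (x # M) - 1}. P j) \<longleftrightarrow>
      P 1 \<and> (\<forall>j\<in>{1..length M - 1}. P (Suc j))" for P
    unfolding split by blast
  have "top_entry (x # M) (length (x # M)) = top_entry M (length M)"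
    "bot_entry (x # M) (length (x # M)) = bot_entry M (length M)"
    by (simp_all add: M top_entry_def bot_entry_def)
  moreover have "top_entry (x # M) (1 + 1) = fst y" "bot_entry (x # M) (1 + 1) = snd y"
    by (simp_all add: M top_entry_def bot_entry_def)
  moreover have "(\<forall>j\<in>{1..length M - 1}.
        top_entry (x # M) (Suc j) = top_entry (x # M) (Suc j + 1) + bot_entry (x # M) (Suc j + 1))
      \<longleftrightarrow> (\<forall>j\<in>{1..length M - 1}. top_entry M j = top_entry M (j + 1) + bot_entry M (j + 1))"
    by (intro ball_cong refl) (simp add: top_entry_Cons_Suc bot_entry_Cons_Suc)
  ultimately show ?thesis
    unfolding two_line_matrices_def mem_Collect_eq ball using assms
    by (auto simp: M Suc_le_eq)
qed

lemma entry_sum_Cons: "entry_sum (x # M) = fst x + snd x + entry_sum M"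
proof -
  have "entry_sum (x # M) = fst x + snd x +
      (\<Sum>j=Suc 1..Suc (length M). top_entry (x # M) j + bot_entry (x # M) j)"
    unfolding entry_sum_def by (subst sum.atLeast_Suc_atMost) simp_all
  also have "(\<Sum>j=Suc 1..Suc (length M). top_entry (x # M) j + bot_entry (x # M) j) = entry_sum M"
    unfolding entry_sum_def sum.atLeast_Suc_atMost_Suc_shift
    by (intro sum.cong refl) (simp add: top_entry_Cons_Suc bot_entry_Cons_Suc)
  finally show ?thesis .
qed

text \<open>The terms are the \<open>n\<close> consecutive odd numbers from \<open>2 * A - 1\<close>
  down to \<open>2 * A - 2 * n + 1\<close>, whose mean is \<open>2 * A - n\<close>.\<close>

lemma sum_odd_descending:
  "(\<Sum>i<n. 2 * (A - int i) - 1) = int n * (2 * A - int n)"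
  by (induction n) (auto simp: algebra_simps)

text \<open>The blocks of \<open>M\<close> keep their values when \<open>x\<close> is put in front.
  The new block \<open>k = 1\<close> consists of descending odd numbers starting from
  \<open>2 * N - 1\<close> with \<open>N = fst x + entry_sum M\<close>, since \<open>N\<close> omits
  \<open>snd x\<close>.\<close>

lemma path_value_Cons:
  assumes "M \<noteq> []"
  shows "path_value (x # M) = int (fst x) * (int (fst x) + 2 * int (entry_sum M)) + path_value M"
proof -
  obtain y M' where M: "M = y # M'"
    using assms by (cases M) auto
  define N where "N = int (entry_sum (x # M)) - int (snd x)"
  define N' where "N' = int (entry_sum M) - int (snd y)"
  define A where "A = (\<lambda>k. N - (\<Sum>j=2..k. int (bot_entry (x # M) j))
               - (\<Sum>j=1..k - 1. int (top_entry (x # M) j)))"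
  define A' where "A' = (\<lambda>k. N' - (\<Sum>j=2..k. int (bot_entry M j))
               - (\<Sum>j=1..k - 1. int (top_entry M j)))"
  have N: "N = int (fst x) + int (entry_sum M)"
    by (simp add: N_def entry_sum_Cons)
  \<comment> \<open>\<open>N\<close> exceeds \<open>N'\<close> by \<open>fst x + snd y\<close>, and
    these are exactly the two terms that \<open>x\<close> adds to the subtracted sums: the bottom
    sum starts at index 2, so it gains \<open>snd y\<close> and not \<open>snd x\<close>.\<close>
  have shift: "A (Suc k) = A' k" if k: "k \<ge> 1" for k
  proof -
    obtain l where l: "k = Suc l"
      using k by (cases k) auto
    have "(\<Sum>j=2..Suc k. int (bot_entry (x # M) j)) = (\<Sum>j=1..k. int (bot_entry M j))"
      unfolding numeral_2_eq_2 sum.atLeast_Suc_atMost_Suc_shift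
      by (intro sum.cong) (auto simp: bot_entry_Cons_Suc)
    also have "\<dots> = int (snd y) + (\<Sum>j=2..k. int (bot_entry M j))"
      using k by (subst sum.atLeast_Suc_atMost) (auto simp: M numeral_2_eq_2)
    finally have bot: "(\<Sum>j=2..Suc k. int (bot_entry (x # M) j)) =
      int (snd y) + (\<Sum>j=2..k. int (bot_entry M j))" .
    have "(\<Sum>j=1..k. int (top_entry (x # M) j)) =
        int (fst x) + (\<Sum>j=Suc 1..Suc l. int (top_entry (x # M) j))"
      unfolding l by (subst sum.atLeast_Suc_atMost) auto
    also have "(\<Sum>j=Suc 1..Suc l. int (top_entry (x # M) j)) = (\<Sum>j=1..l. int (top_entry M j))"
      unfolding sum.atLeast_Suc_atMost_Suc_shift
      by (intro sum.cong) (auto simp: top_entry_Cons_Suc)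
    finally show ?thesis
      using bot unfolding A_def A'_def N N'_def by (simp add: l)
  qed
  have "path_value (x # M) =
      (\<Sum>k=1..Suc (length M'). \<Sum>i<top_entry (x # M) k. 2 * (A k - int i) - 1)"
    by (simp add: path_value_def A_def N_def M Let_def)
  also have "\<dots> = (\<Sum>i<fst x. 2 * (N - int i) - 1) +
      (\<Sum>k=Suc 1..Suc (length M'). \<Sum>i<top_entry (x # M) k. 2 * (A k - int i) - 1)"
    by (subst sum.atLeast_Suc_atMost) (simp_all add: A_def)
  also have "(\<Sum>k=Suc 1..Suc (length M'). \<Sum>i<top_entry (x # M) k. 2 * (A k - int i) - 1) =
      (\<Sum>k=1..length M'. \<Sum>i<top_entry M k. 2 * (A' k - int i) - 1)"
    unfolding sum.atLeast_Suc_atMost_Suc_shift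
    by (intro sum.cong) (auto simp: top_entry_Cons_Suc shift)
  also have "\<dots> = path_value M"
    by (simp add: path_value_def A'_def N'_def M Let_def)
  finally show ?thesis
    unfolding sum_odd_descending by (simp add: N algebra_simps)
qed

text \<open>The bottom entries after the first are differences of consecutive top entries and
  telescope to \<open>c_1 - c_s = c_1\<close>, so the bottom row sums to
  \<open>c_1 + d_1\<close>.\<close>

lemma entry_sum_conv_tops:
  assumes "M \<in> two_line_matrices"
  shows "entry_sum M = fst (hd M) + snd (hd M) + sum_list (map fst M)"
  using assms
proof (induction M)
  case Nil
  then show ?case by (simp add: two_line_matrices_def)
next
  case (Cons x M)
  show ?case
  proof (cases "M = []")
    case True
    then show ?thesis
      using Cons.prems by (simp add: two_line_matrices_singleton entry_sum_def)
  next
    case False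
    then show ?thesis
      using Cons by (simp add: two_line_matrices_Cons entry_sum_Cons)
  qed
qed

text \<open>Let \<open>c\<close> be the new top entry and \<open>S\<close> the sum of the top row of
  \<open>M\<close>. As \<open>entry_sum M = c + S\<close>, the first block is
  \<open>c * (3 * c + 2 * S)\<close>, which equals \<open>(c + S)^2 - S^2 + 2 * c^2\<close>.\<close>

lemma path_value_conv_tops:
  assumes "M \<in> two_line_matrices"
  shows "path_value M = int ((sum_list (map fst M))\<^sup>2 + 2 * (\<Sum>x\<leftarrow>M. (fst x)\<^sup>2))"
  using assms
proof (induction M)
  case Nil
  then show ?case by (simp add: two_line_matrices_def)
next
  case (Cons x M)
  show ?case
  proof (cases "M = []")
    case True
    then show ?thesis
      using Cons.prems by (simp add: two_line_matrices_singleton path_value_def)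
  next
    case False
    then show ?thesis
      using Cons
      by (simp add: two_line_matrices_Cons path_value_Cons entry_sum_conv_tops
          power2_eq_square algebra_simps)
  qed
qed

section \<open>Matrices with \<open>d_1 = 0\<close> and partitions\<close>

text \<open>The matrix with top row \<open>cs\<close> followed by 0 whose first column sums to \<open>p\<close>.\<close>

fun matrix_of_tops :: "nat \<Rightarrow> nat list \<Rightarrow> two_line" where
  "matrix_of_tops p [] = [(0, p)]"
| "matrix_of_tops p (c # cs) = (c, p - c) # matrix_of_tops c cs"

lemma matrix_of_tops_neq_Nil [simp]: "matrix_of_tops p cs \<noteq> []"
  by (cases cs) auto

lemma butlast_map_fst_matrix_of_tops [simp]: "butlast (map fst (matrix_of_tops p cs)) = cs"
  by (induction p cs rule: matrix_of_tops.induct) auto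

text \<open>The ordering makes each truncated difference \<open>p - c\<close> exact. The last column
  is \<open>(0, q)\<close> with \<open>q\<close> the last element of \<open>p # cs\<close>, so the
  absence of 0 gives \<open>d_s \<noteq> 0\<close>.\<close>

lemma matrix_of_tops_in_two_line_matrices:
  assumes "sorted_wrt (\<ge>) (p # cs)" "0 \<notin> set (p # cs)"
  shows "matrix_of_tops p cs \<in> two_line_matrices \<and>
    fst (hd (matrix_of_tops p cs)) + snd (hd (matrix_of_tops p cs)) = p"
  using assms
  by (induction p cs rule: matrix_of_tops.induct)
    (auto simp: two_line_matrices_singleton two_line_matrices_Cons)

text \<open>Each column sum is the preceding top entry, and \<open>p\<close> acts as an entry before
  the first, so the top row and \<open>p\<close> determine the bottom row. Column sums weakly
  decrease to the right, and the last one is \<open>d_s > 0\<close>.\<close>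

lemma two_line_matrix_eq_matrix_of_tops:
  assumes "M \<in> two_line_matrices" "fst (hd M) + snd (hd M) = p"
  shows "M = matrix_of_tops p (butlast (map fst M)) \<and>
    sorted_wrt (\<ge>) (p # butlast (map fst M)) \<and> 0 \<notin> set (p # butlast (map fst M))"
  using assms
proof (induction M arbitrary: p)
  case Nil
  then show ?case by (simp add: two_line_matrices_def)
next
  case (Cons x M)
  show ?case
  proof (cases "M = []")
    case True
    then show ?thesis
      using Cons.prems by (cases x) (auto simp: two_line_matrices_singleton)
  next
    case False
    with Cons.prems have "M \<in> two_line_matrices" "fst (hd M) + snd (hd M) = fst x"
      by (auto simp: two_line_matrices_Cons)
    from Cons.IH[OF this] show ?thesis
      using Cons.prems False by (cases x) auto
  qed
qed

lemma last_two_line_matrix: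
  assumes "M \<in> two_line_matrices"
  shows "map fst M = butlast (map fst M) @ [0]"
proof -
  have "length M \<ge> 1" and "top_entry M (length M) = 0"
    using assms unfolding two_line_matrices_def by blast+
  moreover from this have ne: "M \<noteq> []"
    by auto
  ultimately have "last (map fst M) = 0"
    by (simp add: top_entry_def last_map last_conv_nth)
  with ne append_butlast_last_id[of "map fst M"] show ?thesis
    by (metis map_is_Nil_conv)
qed

definition partitions :: "nat list set" where
  "partitions = {cs. cs \<noteq> [] \<and> sorted_wrt (\<ge>) cs \<and> 0 \<notin> set cs}"

lemma matrix_of_tops_in_two_line_matrices0:
  assumes "cs \<in> partitions"
  shows "matrix_of_tops (hd cs) cs \<in> two_line_matrices0"
proof -
  obtain c cs' where cs: "cs = c # cs'"
    using assms by (cases cs) (auto simp: partitions_def)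
  have "sorted_wrt (\<ge>) (c # cs)" "0 \<notin> set (c # cs)"
    using assms by (auto simp: cs partitions_def)
  from matrix_of_tops_in_two_line_matrices[OF this] show ?thesis
    by (simp add: cs two_line_matrices0_def)
qed

lemma two_line_matrix0_eq_matrix_of_tops:
  assumes "M \<in> two_line_matrices0"
  defines "cs \<equiv> butlast (map fst M)"
  shows "cs \<in> partitions" "M = matrix_of_tops (hd cs) cs"
proof -
  have M: "M \<in> two_line_matrices" and bot: "bot_entry M 1 = 0"
    using assms by (auto simp: two_line_matrices0_def)
  then have *: "M = matrix_of_tops (fst (hd M) + snd (hd M)) cs \<and>
      sorted_wrt (\<ge>) ((fst (hd M) + snd (hd M)) # cs) \<and> 0 \<notin> set ((fst (hd M) + snd (hd M)) # cs)"
    unfolding cs_def by (intro two_line_matrix_eq_matrix_of_tops refl)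
  obtain x M' where x: "M = x # M'"
    using M by (cases M) (auto simp: two_line_matrices_def)
  \<comment> \<open>In a single column \<open>d_1\<close> is also \<open>d_s\<close>, which is
    nonzero.\<close>
  have "M' \<noteq> []"
    using M bot by (auto simp: x two_line_matrices_singleton)
  then have "cs \<noteq> []" "hd cs = fst (hd M) + snd (hd M)"
    using bot by (auto simp: cs_def x)
  with * show "cs \<in> partitions" "M = matrix_of_tops (hd cs) cs"
    by (auto simp: partitions_def)
qed

lemma bij_betw_partitions_two_line_matrices0:
  "bij_betw (\<lambda>cs. matrix_of_tops (hd cs) cs)
     {cs \<in> partitions. int ((sum_list cs)\<^sup>2 + 2 * (\<Sum>c\<leftarrow>cs. c\<^sup>2)) = m}
     {M \<in> two_line_matrices0. path_value M = m}"
proof -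
  have pv: "path_value M = int ((sum_list (butlast (map fst M)))\<^sup>2
      + 2 * (\<Sum>c\<leftarrow>butlast (map fst M). c\<^sup>2))" if "M \<in> two_line_matrices0" for M
  proof -
    have M: "M \<in> two_line_matrices"
      using that by (simp add: two_line_matrices0_def)
    define cs where "cs = butlast (map fst M)"
    have cs: "map fst M = cs @ [0]"
      using last_two_line_matrix[OF M] by (simp only: cs_def)
    have "(\<Sum>x\<leftarrow>M. (fst x)\<^sup>2) = (\<Sum>c\<leftarrow>map fst M. c\<^sup>2)"
      by (simp add: comp_def)
    also have "\<dots> = (\<Sum>c\<leftarrow>cs. c\<^sup>2)"
      unfolding cs by simp
    finally show ?thesis
      unfolding path_value_conv_tops[OF M] cs_def[symmetric] by (simp add: cs)
  qed
  show ?thesis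
  proof (rule bij_betw_byWitness[where f' = "\<lambda>M. butlast (map fst M)"], goal_cases)
    case 3
    show ?case
      using pv[OF matrix_of_tops_in_two_line_matrices0]
      by (auto simp: matrix_of_tops_in_two_line_matrices0)
  qed (use pv in \<open>auto simp: two_line_matrix0_eq_matrix_of_tops(1)
      simp flip: two_line_matrix0_eq_matrix_of_tops(2)\<close>)
qed

section \<open>Padding partitions with zeros\<close>

lemma sorted_eq_filter_append_zeros:
  fixes xs :: "nat list"
  assumes "sorted_wrt (\<ge>) xs"
  shows "xs = filter (\<lambda>x. x \<noteq> 0) xs
    @ replicate (length xs - length (filter (\<lambda>x. x \<noteq> 0) xs)) 0"
  using assms
proof (induction xs)
  case (Cons x xs)
  show ?case
  proof (cases "x = 0")
    case True
    then have "\<forall>y\<in>set (x # xs). y = 0"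
      using Cons.prems by auto
    then have "x # xs = replicate (length (x # xs)) 0" "filter (\<lambda>x. x \<noteq> 0) (x # xs) = []"
      by (auto simp: replicate_length_same[symmetric] filter_empty_conv map_idI
          intro!: replicate_eqI)
    then show ?thesis by simp
  next
    case False
    then show ?thesis using Cons by simp
  qed
qed simp

text \<open>Every part is at least 1. Hence the padding length
  \<open>sum_list cs - length cs\<close> is not truncated.\<close>

lemma length_le_sum_list:
  fixes cs :: "nat list"
  assumes "0 \<notin> set cs"
  shows "length cs \<le> sum_list cs"
  using assms by (induction cs) auto

lemma sum_list_power2_cong:
  "[(\<Sum>c\<leftarrow>cs. c\<^sup>2) = sum_list cs] (mod (2 :: nat))"
  by (induction cs) (auto simp: cong_def mod2_eq_if)

lemma sum_list_filter_nonzero: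
  "sum_list (filter (\<lambda>x. x \<noteq> 0) xs) = sum_list (xs :: nat list)"
  "(\<Sum>x\<leftarrow>filter (\<lambda>x. x \<noteq> 0) xs. x\<^sup>2) = (\<Sum>x\<leftarrow>xs. x\<^sup>2)"
  by (induction xs) auto

text \<open>Deleting the zeros inverts the padding. Since \<open>m > 0\<close>, the pair
  \<open>a = b = 0\<close> is excluded, whose only solution is the empty list; that list is not in
  \<open>partitions\<close>.\<close>

lemma bij_betw_partitions_system_solutions:
  assumes "m > 0"
  shows "bij_betw (\<lambda>cs. ((\<Sum>c\<leftarrow>cs. c\<^sup>2, sum_list cs), cs @ replicate (sum_list cs - length cs) 0))
    {cs \<in> partitions. int ((sum_list cs)\<^sup>2 + 2 * (\<Sum>c\<leftarrow>cs. c\<^sup>2)) = m}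
    (SIGMA (a, b) : {(a, b). [a = b] (mod 2) \<and> m = int (b\<^sup>2 + 2 * a)}. system_solutions a b)"
  (is "bij_betw ?f ?A ?B")
proof (rule bij_betw_byWitness[where f' = "\<lambda>(_, xs). filter (\<lambda>x. x \<noteq> 0) xs"])
  show "\<forall>cs\<in>?A. (\<lambda>(_, xs). filter (\<lambda>x. x \<noteq> 0) xs) (?f cs) = cs"
  proof
    fix cs assume "cs \<in> ?A"
    then have "filter (\<lambda>x. x \<noteq> 0) cs = cs"
      by (intro filter_True) (metis (lifting) mem_Collect_eq partitions_def)
    then show "(\<lambda>(_, xs). filter (\<lambda>x. x \<noteq> 0) xs) (?f cs) = cs"
      by simp
  qed
  show "\<forall>p\<in>?B. ?f ((\<lambda>(_, xs). filter (\<lambda>x. x \<noteq> 0) xs) p) = p"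
  proof
    fix p assume "p \<in> ?B"
    then obtain a b xs where p: "p = ((a, b), xs)" and xs: "xs \<in> system_solutions a b"
      by auto
    \<comment> \<open>The equation \<open>length xs = sum_list xs\<close> fixes the number of
      trailing zeros, so they can be restored after filtering.\<close>
    from xs have "a = (\<Sum>x\<leftarrow>xs. x\<^sup>2)" "b = sum_list xs" "length xs = sum_list xs"
      and "sorted_wrt (\<ge>) xs"
      by (simp_all add: system_solutions_def)
    with sorted_eq_filter_append_zeros[of xs]
    show "?f ((\<lambda>(_, xs). filter (\<lambda>x. x \<noteq> 0) xs) p) = p"
      unfolding p prod.case sum_list_filter_nonzero by metis
  qed
  have "sorted_wrt (\<ge>) (replicate n (0 :: nat))" for n
    by (induction n) auto
  then show "?f ` ?A \<subseteq> ?B"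
    by (auto simp: system_solutions_def partitions_def sum_list_power2_cong sorted_wrt_append
        length_le_sum_list sum_list_replicate)
  show "(\<lambda>(_, xs). filter (\<lambda>x. x \<noteq> 0) xs) ` ?B \<subseteq> ?A"
  proof clarsimp
    fix a b xs
    assume m: "m = (int b)\<^sup>2 + 2 * int a" and xs: "xs \<in> system_solutions a b"
    have sums: "b = sum_list xs" "a = (\<Sum>x\<leftarrow>xs. x\<^sup>2)" and sorted: "sorted_wrt (\<ge>) xs"
      using xs by (auto simp: system_solutions_def)
    have "filter (\<lambda>x. x \<noteq> 0) xs \<noteq> []"
    proof
      assume "filter (\<lambda>x. x \<noteq> 0) xs = []"
      then have "a = 0" "b = 0"
        using sums sum_list_filter_nonzero[of xs] by auto
      then show False using m assms by simp
    qed
    then show "filter (\<lambda>x. 0 < x) xs \<in> partitions \<and>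
        (int (sum_list (filter (\<lambda>x. 0 < x) xs)))\<^sup>2
          + 2 * int (\<Sum>x\<leftarrow>filter (\<lambda>x. 0 < x) xs. x\<^sup>2) = (int b)\<^sup>2 + 2 * int a"
      using sums sorted sum_list_filter_nonzero[of xs]
      by (auto simp: partitions_def sorted_wrt_filter)
  qed
qed

lemma finite_system_solutions: "finite (system_solutions a b)"
proof (rule finite_subset)
  show "system_solutions a b \<subseteq> {xs. set xs \<subseteq> {..b} \<and> length xs = b}"
    by (auto simp: system_solutions_def member_le_sum_list)
  show "finite {xs. set xs \<subseteq> {..b} \<and> length xs = b}"
    by (rule finite_lists_length_eq) simp
qed

text \<open>Both coordinates are at most \<open>m\<close>. With the finiteness of each solution set,
  this lets the cardinality of the disjoint union be written as a sum over
  \<open>(a, b)\<close>.\<close>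

lemma finite_square_plus_double:
  "finite {(a :: nat, b :: nat). [a = b] (mod 2) \<and> m = int (b\<^sup>2 + 2 * a)}"
proof (rule finite_subset)
  have "b \<le> b\<^sup>2" for b :: nat
    by (simp add: power2_eq_square)
  then have "a \<le> nat (int (b\<^sup>2 + 2 * a)) \<and> b \<le> nat (int (b\<^sup>2 + 2 * a))" for a b :: nat
    unfolding nat_int by (simp add: trans_le_add1)
  then show "{(a :: nat, b :: nat). [a = b] (mod 2) \<and> m = int (b\<^sup>2 + 2 * a)}
      \<subseteq> {..nat m} \<times> {..nat m}"
    by blast
qed simp

theorem theorem4p4:
  fixes m :: int
  assumes "m > 0"
    and "m \<in> path_value ` two_line_matrices"
  shows "frequency m =
    (\<Sum>(a, b) \<in> {(a :: nat, b :: nat). [a = b] (mod 2) \<and> m = int (b\<^sup>2 + 2 * a)}.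
       card (system_solutions a b))"
proof -
  let ?I = "{(a :: nat, b :: nat). [a = b] (mod 2) \<and> m = int (b\<^sup>2 + 2 * a)}"
  have "frequency m = card {cs \<in> partitions. int ((sum_list cs)\<^sup>2 + 2 * (\<Sum>c\<leftarrow>cs. c\<^sup>2)) = m}"
    unfolding frequency_def
    by (rule bij_betw_same_card[OF bij_betw_partitions_two_line_matrices0, symmetric])
  also have "\<dots> = card (SIGMA (a, b) : ?I. system_solutions a b)"
    by (rule bij_betw_same_card[OF bij_betw_partitions_system_solutions[OF assms(1)]])
  also have "\<dots> = (\<Sum>p\<in>?I. card (case p of (a, b) \<Rightarrow> system_solutions a b))"
    by (rule card_SigmaI) (use finite_square_plus_double finite_system_solutions in auto)
  also have "\<dots> = (\<Sum>(a, b)\<in>?I. card (system_solutions a b))"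
    by (intro sum.cong) auto
  finally show ?thesis .
qed

end
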